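(* Let $A$ be a finite alphabet and let $F:A^{\mathbb N}\to A^{\mathbb N}$ be a dill map with diameter $\theta$ and local rule $f$. Then $F$ induces a well-defined map on the quotient space $X_{W_L}$ (i.e. for all $x,y\in A^{\mathbb N}$, $W_L(x,y)=0$ implies $W_L(F(x),F(y))=0$) if and only if $F$ is $W_L$-constant or diamond-uniform.
   Context: For a word $u$ (or $x\in A^{\mathbb N}$) write $u_{[a,b)}=u_a\cdots u_{b-1}$. The Levenshtein distance of finite words $u,v$ is $d_L(u,v)=\frac12\min\{m+m'\}$ over all ways of deleting $m$ letters from $u$ and $m'$ letters from $v$ so that the resulting words coincide. The pseudo-metric $W_L$ on $A^{\mathbb N}$ is $W_L(x,y)=\limsup_{\ell\to\infty}\max_{k\in\mathbb N}\frac{d_L(x_{[k,k+\ell)},y_{[k,k+\ell)})}{\ell}$, and $X_{W_L}$ is the quotient of $A^{\mathbb N}$ by $x\sim y\iff W_L(x,y)=0$. A dill map with diameter $\theta\in\mathbb N\setminus\{0\}$ and local rule $f:A^\theta\to A^+$ (nonempty words) is $F(x)=f(x_{[0,\theta)})f(x_{[1,\theta+1)})f(x_{[2,\theta+2)})\cdots$. Extend $f$ to $f^*:A^*\to A^*$ by $f^*(u)=f(u_{[0,\theta)})f(u_{[1,\theta+1)})\cdots f(u_{[|u|-\theta,|u|)})$ if $|u|\ge\theta$ and $f^*(u)$ the empty word otherwise. $F$ is $W_L$-constant if $W_L(F(x),F(y))=0$ for all $x,y$. $F$ is diamond-uniform if for every $\ell$ and all $u,v\in A^\ell$ with $u_{[0,\theta)}=v_{[0,\theta)}$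 and $u_{[\ell-\theta,\ell)}=v_{[\ell-\theta,\ell)}$, one has $|f^*(u)|=|f^*(v)|$. *)

theory Defs
  imports "HOL-Library.Sublist" "HOL-Library.Extended_Real"
begin

(* The alphabet is a type of class finite, A^N is nat => 'a, and A^* is 'a list. *)

definition window :: "(nat \<Rightarrow> 'a) \<Rightarrow> nat \<Rightarrow> nat \<Rightarrow> 'a list" where
  "window x a b = map x [a..<b]"

(* Deleting letters from a word produces exactly its (scattered) subsequences;
   w is the common word that remains. Taking w = [] shows that LEAST is well defined. *)
definition levenshtein :: "'a list \<Rightarrow> 'a list \<Rightarrow> real" where
  "levenshtein u v =
     real (LEAST n. \<exists>m m' w. n = m + m' \<and>
             subseq w u \<and> length u = length w + m \<and>
             subseq w v \<and> length v = length w + m') / 2"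

(* For fixed l the words have length l, so only finitely many values occur over k
   and the supremum is a maximum. Values are in ereal, where SUP and limsup are total;
   the term at l = 0 is irrelevant for the limsup. *)
definition W_L :: "(nat \<Rightarrow> 'a) \<Rightarrow> (nat \<Rightarrow> 'a) \<Rightarrow> ereal" where
  "W_L x y =
     limsup (\<lambda>l. SUP k. ereal (levenshtein (window x k (k + l)) (window y k (k + l)) / real l))"

(* If all w i are nonempty, the concatenation of w 0, ..., w n has more than n letters. *)
definition inf_concat :: "(nat \<Rightarrow> 'a list) \<Rightarrow> nat \<Rightarrow> 'a" where
  "inf_concat w n = concat (map w [0..<Suc n]) ! n"

lemma window_inf_concat:
  assumes "\<And>i. w i \<noteq> []"
  shows "window (inf_concat w) 0 (length (concat (map w [0..<n]))) = concat (map w [0..<n])"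
proof -
  have len: "n \<le> length (concat (map w [0..<n]))" for n
  proof (induction n)
    case (Suc n)
    have "Suc 0 \<le> length (w n)" using assms[of n] by (cases "w n") auto
    then have "Suc n \<le> length (concat (map w [0..<n])) + length (w n)" using Suc by linarith
    then show ?case by simp
  qed simp
  have ext: "concat (map w [0..<b]) ! i = concat (map w [0..<a]) ! i"
    if "a \<le> b" "i < length (concat (map w [0..<a]))" for a b i
  proof -
    have "[0..<b] = [0..<a] @ [a..<b]"
      using that(1) by (metis le_add_diff_inverse upt_add_eq_append zero_le)
    then show ?thesis using that(2) by (simp add: nth_append)
  qed
  show ?thesis
  proof (rule nth_equalityI)
    fix i assume "i < length (window (inf_concat w) 0 (length (concat (map w [0..<n]))))"
    then have i: "i < length (concat (map w [0..<n]))"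
      by (simp add: window_def)
    have "i < length (concat (map w [0..<Suc i]))" using len[of "Suc i"] by linarith
    then have "concat (map w [0..<Suc i]) ! i = concat (map w [0..<n]) ! i"
      using ext i by (metis nat_le_linear)
    with i show "window (inf_concat w) 0 (length (concat (map w [0..<n]))) ! i
        = concat (map w [0..<n]) ! i"
      by (simp add: window_def inf_concat_def)
  qed (simp add: window_def)
qed

(* Only the values of f on words of length \<theta> matter. *)
definition is_dill_map ::
    "nat \<Rightarrow> ('a list \<Rightarrow> 'a list) \<Rightarrow> ((nat \<Rightarrow> 'a) \<Rightarrow> (nat \<Rightarrow> 'a)) \<Rightarrow> bool" where
  "is_dill_map \<theta> f F \<longleftrightarrow>
     \<theta> \<noteq> 0 \<and>
     (\<forall>u. length u = \<theta> \<longrightarrow> f u \<noteq> []) \<and>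
     (\<forall>x. F x = inf_concat (\<lambda>i. f (window x i (i + \<theta>))))"

definition word_ext :: "nat \<Rightarrow> ('a list \<Rightarrow> 'a list) \<Rightarrow> 'a list \<Rightarrow> 'a list" where
  "word_ext \<theta> f u =
     (if \<theta> \<le> length u
      then concat (map (\<lambda>i. f (take \<theta> (drop i u))) [0..<length u - \<theta> + 1])
      else [])"

definition W_L_constant :: "((nat \<Rightarrow> 'a) \<Rightarrow> (nat \<Rightarrow> 'a)) \<Rightarrow> bool" where
  "W_L_constant F \<longleftrightarrow> (\<forall>x y. W_L (F x) (F y) = 0)"

(* The factors of length \<theta> only exist for \<theta> \<le> l; for shorter words both
   images are empty anyway. *)
definition diamond_uniform :: "nat \<Rightarrow> ('a list \<Rightarrow> 'a list) \<Rightarrow> bool" where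
  "diamond_uniform \<theta> f \<longleftrightarrow>
     (\<forall>l\<ge>\<theta>. \<forall>u v. length u = l \<longrightarrow> length v = l \<longrightarrow>
        take \<theta> u = take \<theta> v \<longrightarrow> drop (l - \<theta>) u = drop (l - \<theta>) v \<longrightarrow>
        length (word_ext \<theta> f u) = length (word_ext \<theta> f v))"

end

theory Submission
  imports Defs
begin

text \<open>\<open>W_L x y = 0\<close> means that windows of length \<open>l\<close> differ by at most \<open>\<epsilon> * l + C\<close>,
  uniformly in their position. Up to additive constants, word extensions are additive under
  concatenation, are Lipschitz for the Levenshtein distance, and describe the factors of the image.
  If the rule is diamond-uniform, the images of two prefixes of equal length have lengths that differ
  by a bounded amount, so windows of the two images come from windows of the arguments at nearby
  positions. Otherwise take \<open>u\<close>, \<open>v\<close> with equal ends and length whose images have different lengths.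
  The points \<open>u G\<^sub>0 u G\<^sub>1 \<dots>\<close> and \<open>v G\<^sub>0 v G\<^sub>1 \<dots>\<close> are equivalent as soon as \<open>n \<le> |G\<^sub>n|\<close>, since a window
  of length \<open>l\<close> meets only \<open>O(\<surd>l)\<close> of the replaced words; but inside \<open>G\<^sub>n\<close> the images are shifted
  against each other by an amount that grows linearly in \<open>n\<close>. Hence \<open>G\<^sub>n\<close> can be chosen such that
  windows of length about \<open>n\<close> of \<open>F x\<close> and \<open>F y\<close>, for arbitrary \<open>x\<close> and \<open>y\<close>, face each other, which
  forces \<open>W_L (F x) (F y) = 0\<close>.\<close>

section \<open>The Levenshtein distance\<close>

lemma levenshtein_le:
  assumes "subseq w u" "subseq w v"
  shows "levenshtein u v \<le> (real (length u) + real (length v)) / 2 - real (length w)"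
proof -
  let ?P = "\<lambda>n. \<exists>m m' w. n = m + m' \<and> subseq w u \<and> length u = length w + m \<and>
             subseq w v \<and> length v = length w + m'"
  have l: "length w \<le> length u" "length w \<le> length v"
    using assms by (auto dest: list_emb_length)
  have "?P ((length u - length w) + (length v - length w))"
    using assms l by (metis le_add_diff_inverse)
  then have "(LEAST n. ?P n) \<le> (length u - length w) + (length v - length w)"
    by (rule Least_le)
  then have "real (LEAST n. ?P n) \<le> real ((length u - length w) + (length v - length w))"
    by (simp only: of_nat_le_iff)
  also have "\<dots> = real (length u) + real (length v) - 2 * real (length w)"
    using l by simp
  finally show ?thesis unfolding levenshtein_def by (simp add: field_simps)
qed

lemma levenshtein_witness:
  obtains w where "subseq w u" "subseq w v"
    "levenshtein u v = (real (length u) + real (length v)) / 2 - real (length w)"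
proof -
  let ?P = "\<lambda>n. \<exists>m m' w. n = m + m' \<and> subseq w u \<and> length u = length w + m \<and>
             subseq w v \<and> length v = length w + m'"
  have "?P (length u + length v)" by (rule exI[of _ "length u"], rule exI[of _ "length v"]) auto
  then have "?P (LEAST n. ?P n)" by (rule LeastI)
  then obtain m m' w where w: "(LEAST n. ?P n) = m + m'" "subseq w u" "length u = length w + m"
    "subseq w v" "length v = length w + m'" by blast
  have "levenshtein u v = real (m + m') / 2" unfolding levenshtein_def w(1) ..
  then have "levenshtein u v = (real (length u) + real (length v)) / 2 - real (length w)"
    using w(3,5) by (simp add: field_simps)
  with w that show thesis by blast
qed

lemma levenshtein_nonneg: "0 \<le> levenshtein u v"
  by (simp add: levenshtein_def)

lemma levenshtein_commute: "levenshtein u v = levenshtein v u"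
proof -
  have "levenshtein u v \<le> levenshtein v u" for u v :: "'a list"
  proof -
    obtain w where "subseq w v" "subseq w u"
      "levenshtein v u = (real (length v) + real (length u)) / 2 - real (length w)"
      by (rule levenshtein_witness)
    then show ?thesis using levenshtein_le[of w u v] by (simp add: add.commute)
  qed
  then show ?thesis by (intro antisym)
qed

lemma levenshtein_refl [simp]: "levenshtein u u = 0"
  using levenshtein_le[of u u u] levenshtein_nonneg[of u u] by simp

lemma levenshtein_subseq:
  "subseq w u \<Longrightarrow> 2 * levenshtein w u \<le> real (length u) - real (length w)"
  using levenshtein_le[of w w u] by (simp add: field_simps)

lemma levenshtein_subseq_le:
  assumes "subseq w u" "length u \<le> length w + m"
  shows "levenshtein w u \<le> real m"
proof -
  have "real (length u) \<le> real (length w) + real m"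
    using assms(2) by linarith
  moreover have "0 \<le> real m" by simp
  ultimately show ?thesis using levenshtein_subseq[OF assms(1)] by linarith
qed

lemma levenshtein_le_length:
  "length u = length v \<Longrightarrow> levenshtein u v \<le> real (length u)"
  using levenshtein_le[of "[]" u v] by simp

lemma subseq_Cons_rightE:
  assumes "subseq w (a # v)" "\<not> subseq w v"
  obtains t where "w = a # t" "subseq t v"
  using assms(1) by (rule list_emb.cases) (use assms(2) that in auto)

text \<open>Embeddings of \<open>w\<close> and \<open>w'\<close> in \<open>v\<close> share at least
  \<open>length w + length w' - length v\<close> positions; the letters there form \<open>z\<close>.
  The triangle inequality uses this with \<open>v\<close> as the middle word.\<close>

lemma common_subseq_of_subseqs:
  assumes "subseq w v" "subseq w' v"
  shows "\<exists>z. subseq z w \<and> subseq z w' \<and> length w + length w' \<le> length z + length v"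
  using assms
proof (induction v arbitrary: w w' rule: list.induct)
  case Nil
  then show ?case by auto
next
  case (Cons a v)
  show ?case
  proof (cases "subseq w v")
    case True
    show ?thesis
    proof (cases "subseq w' v")
      case True
      then show ?thesis using Cons.IH[OF \<open>subseq w v\<close> True] by auto
    next
      case False
      with Cons.prems obtain t where t: "w' = a # t" "subseq t v"
        by (metis subseq_Cons_rightE)
      then obtain z where "subseq z w" "subseq z t" "length w + length t \<le> length z + length v"
        using Cons.IH[OF True] by blast
      then show ?thesis using t by (intro exI[of _ z]) auto
    qed
  next
    case False
    with Cons.prems obtain s where s: "w = a # s" "subseq s v"
      by (metis subseq_Cons_rightE)
    show ?thesis
    proof (cases "subseq w' v")
      case True
      then obtain z where "subseq z s" "subseq z w'" "length s + length w' \<le> length z + length v"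
        using Cons.IH[OF s(2)] by blast
      then show ?thesis using s by (intro exI[of _ z]) auto
    next
      case False
      with Cons.prems obtain t where t: "w' = a # t" "subseq t v"
        by (metis subseq_Cons_rightE)
      then obtain z where "subseq z s" "subseq z t" "length s + length t \<le> length z + length v"
        using Cons.IH[OF s(2)] by blast
      then show ?thesis using s t by (intro exI[of _ "a # z"]) auto
    qed
  qed
qed

lemma levenshtein_triangle: "levenshtein u t \<le> levenshtein u v + levenshtein v t"
proof -
  obtain w where w: "subseq w u" "subseq w v"
    "levenshtein u v = (real (length u) + real (length v)) / 2 - real (length w)"
    by (rule levenshtein_witness)
  obtain w' where w': "subseq w' v" "subseq w' t"
    "levenshtein v t = (real (length v) + real (length t)) / 2 - real (length w')"
    by (rule levenshtein_witness)
  obtain z where z: "subseq z w" "subseq z w'" "length w + length w' \<le> length z + length v"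
    using common_subseq_of_subseqs[OF w(2) w'(1)] by blast
  have "levenshtein u t \<le> (real (length u) + real (length t)) / 2 - real (length z)"
    by (rule levenshtein_le[OF subseq_order.trans[OF z(1) w(1)] subseq_order.trans[OF z(2) w'(2)]])
  moreover have "real (length w) + real (length w') \<le> real (length z) + real (length v)"
    using z(3) by linarith
  ultimately show ?thesis using w(3) w'(3) by (simp add: field_simps)
qed

lemma levenshtein_append:
  "levenshtein (a @ b) (c @ d) \<le> levenshtein a c + levenshtein b d"
proof -
  obtain w where w: "subseq w a" "subseq w c"
    "levenshtein a c = (real (length a) + real (length c)) / 2 - real (length w)"
    by (rule levenshtein_witness)
  obtain w' where w': "subseq w' b" "subseq w' d"
    "levenshtein b d = (real (length b) + real (length d)) / 2 - real (length w')"
    by (rule levenshtein_witness)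
  have "levenshtein (a @ b) (c @ d) \<le>
      (real (length (a @ b)) + real (length (c @ d))) / 2 - real (length (w @ w'))"
    using w w' by (intro levenshtein_le list_emb_append_mono)
  then show ?thesis using w(3) w'(3) by (simp add: field_simps)
qed

section \<open>Windows of infinite words and sublinear distances\<close>

lemma length_window [simp]: "length (window x a b) = b - a"
  by (simp add: window_def)

lemma window_append: "a \<le> b \<Longrightarrow> b \<le> c \<Longrightarrow> window x a b @ window x b c = window x a c"
  unfolding window_def
  using upt_add_eq_append[of a b "c - b"] by simp

text \<open>Both windows arise by deletions from the smallest window covering them. The total number
  of deleted letters is the sum of the two endpoint displacements, and each costs one half.\<close>

lemma levenshtein_windows:
  assumes "a \<le> b" "c \<le> d"
  shows "2 * levenshtein (window x a b) (window x c d)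
         \<le> \<bar>real a - real c\<bar> + \<bar>real b - real d\<bar>"
proof -
  let ?l = "min a c" and ?r = "max b d"
  have sub: "subseq (window x a b) (window x ?l ?r)" if "a \<le> b" "?l \<le> a" "b \<le> ?r"
    for a b
  proof -
    have "window x ?l ?r = window x ?l a @ window x a b @ window x b ?r"
      using that by (simp add: window_append)
    then show ?thesis by (simp add: list_emb_append2 list_emb_prefix)
  qed
  have 1: "2 * levenshtein (window x a b) (window x ?l ?r) \<le> real (?r - ?l) - real (b - a)"
    using levenshtein_subseq[OF sub[of a b]] assms by simp
  have 2: "2 * levenshtein (window x ?l ?r) (window x c d) \<le> (real (?r - ?l) - real (d - c))"
    using levenshtein_subseq[OF sub[of c d]] assms
    by (simp add: levenshtein_commute[of "window x ?l ?r"])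
  have "real (?r - ?l) - real (b - a) + (real (?r - ?l) - real (d - c))
      = \<bar>real a - real c\<bar> + \<bar>real b - real d\<bar>"
    using assms by (auto simp: min_def max_def of_nat_diff field_simps)
  with 1 2 levenshtein_triangle[of "window x a b" "window x c d" "window x ?l ?r"]
  show ?thesis by linarith
qed

lemma levenshtein_le_hamming:
  "levenshtein (window x k (k + l)) (window y k (k + l))
   \<le> real (card {i. k \<le> i \<and> i < k + l \<and> x i \<noteq> y i})"
proof -
  let ?is = "filter (\<lambda>i. x i = y i) [k..<k+l]"
  have 1: "subseq (map x ?is) (window x k (k + l))"
    unfolding window_def by (intro subseq_map subseq_filter_left)
  have "map x ?is = map y ?is" by simp
  then have 2: "subseq (map x ?is) (window y k (k + l))"
    unfolding window_def by (simp only:) (intro subseq_map subseq_filter_left)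
  have "length ?is + length (filter (\<lambda>i. x i \<noteq> y i) [k..<k+l]) = l"
    using sum_length_filter_compl[of "\<lambda>i. x i = y i" "[k..<k+l]"] by simp
  moreover have "length (filter (\<lambda>i. x i \<noteq> y i) [k..<k+l])
      = card {i. k \<le> i \<and> i < k + l \<and> x i \<noteq> y i}"
    using distinct_card[of "filter (\<lambda>i. x i \<noteq> y i) [k..<k+l]"]
    by (simp add: conj_commute conj_left_commute)
  ultimately have "real (length ?is) = real l - real (card {i. k \<le> i \<and> i < k + l \<and> x i \<noteq> y i})"
    by linarith
  with levenshtein_le[OF 1 2] show ?thesis by simp
qed

lemma W_L_nonneg: "0 \<le> W_L x y"
  unfolding W_L_def
proof (rule le_Limsup)
  show "\<forall>\<^sub>F l in sequentially. 0 \<le> (SUP k. ereal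
      (levenshtein (window x k (k + l)) (window y k (k + l)) / real l))"
    by (rule always_eventually, rule allI, rule SUP_upper2[OF UNIV_I[of 0]])
      (simp add: levenshtein_nonneg)
qed simp

text \<open>The form used below: bounded errors disappear in \<open>C\<close>. So do the finitely
  many short lengths, since words of length \<open>l\<close> have distance at most
  \<open>l\<close>.\<close>

lemma W_L_eq_0_iff:
  "W_L x y = 0 \<longleftrightarrow>
   (\<forall>\<epsilon>>0. \<exists>C. \<forall>k l. levenshtein (window x k (k + l)) (window y k (k + l)) \<le> \<epsilon> * real l + C)"
proof
  assume W: "W_L x y = 0"
  show "\<forall>\<epsilon>>0. \<exists>C. \<forall>k l. levenshtein (window x k (k + l)) (window y k (k + l)) \<le> \<epsilon> * real l + C"
  proof (intro allI impI)
    fix \<epsilon> :: real assume e: "\<epsilon> > 0"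
    then have "W_L x y < ereal \<epsilon>" using W by simp
    then have "\<forall>\<^sub>F l in sequentially. (SUP k. ereal
      (levenshtein (window x k (k + l)) (window y k (k + l)) / real l)) < ereal \<epsilon>"
      unfolding W_L_def by (rule Limsup_lessD)
    then obtain N where N: "\<And>l. l \<ge> N \<Longrightarrow> (SUP k. ereal
      (levenshtein (window x k (k + l)) (window y k (k + l)) / real l)) < ereal \<epsilon>"
      unfolding eventually_sequentially by blast
    show "\<exists>C. \<forall>k l. levenshtein (window x k (k + l)) (window y k (k + l)) \<le> \<epsilon> * real l + C"
    proof (intro exI allI)
      fix k l
      show "levenshtein (window x k (k + l)) (window y k (k + l)) \<le> \<epsilon> * real l + real N"
      proof (cases "N \<le> l \<and> 0 < l")
        case True
        have "ereal (levenshtein (window x k (k + l)) (window y k (k + l)) / real l) \<le> (SUP k. ereal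
      (levenshtein (window x k (k + l)) (window y k (k + l)) / real l))"
          by (rule SUP_upper) simp
        also have "\<dots> < ereal \<epsilon>" using N True by blast
        finally have "levenshtein (window x k (k + l)) (window y k (k + l)) / real l < \<epsilon>" by simp
        then have "levenshtein (window x k (k + l)) (window y k (k + l)) < \<epsilon> * real l"
          using True by (simp add: divide_less_eq)
        then show ?thesis by linarith
      next
        case False
        then have "l \<le> N" by auto
        moreover have "levenshtein (window x k (k + l)) (window y k (k + l)) \<le> real l"
          using levenshtein_le_length[of "window x k (k + l)" "window y k (k + l)"] by simp
        moreover have "0 \<le> \<epsilon> * real l" using e by simp
        ultimately show ?thesis by linarith
      qed
    qed
  qed
next
  assume H: "\<forall>\<epsilon>>0. \<exists>C. \<forall>k l. levenshtein (window x k (k + l)) (window y k (k + l)) \<le> \<epsilon> * real l + C"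
  have "W_L x y \<le> 0 + ereal e" if e: "e > 0" for e
  proof -
    obtain C where C: "\<And>k l. levenshtein (window x k (k + l)) (window y k (k + l)) \<le> e / 2 * real l + C"
      using H e half_gt_zero by blast
    obtain N where N: "C / (e / 2) < real N" using reals_Archimedean2 by blast
    have "\<forall>\<^sub>F l in sequentially. (SUP k. ereal
      (levenshtein (window x k (k + l)) (window y k (k + l)) / real l)) \<le> ereal e"
      unfolding eventually_sequentially
    proof (intro exI allI impI SUP_least)
      fix l k assume l: "Suc N \<le> l"
      have "C / (e / 2) < real l" using N l by linarith
      then have "C < e / 2 * real l" using e by (simp add: field_simps)
      then have "levenshtein (window x k (k + l)) (window y k (k + l)) \<le> e * real l"
        using C[of k l] by linarith
      then show "ereal (levenshtein (window x k (k + l)) (window y k (k + l)) / real l) \<le> ereal e"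
        using l by (simp add: divide_le_eq)
    qed
    then show ?thesis unfolding W_L_def add_0_left by (rule Limsup_bounded)
  qed
  then have "W_L x y \<le> 0" by (rule ereal_le_epsilon2)
  then show "W_L x y = 0" using W_L_nonneg by (rule antisym)
qed

section \<open>The extension of a local rule to words\<close>

lemma window_prefixD:
  assumes "window z 0 (length (w @ t)) = w @ t"
  shows "window z 0 (length w) = w" "window z (length w) (length (w @ t)) = t"
proof -
  have "window z 0 (length w) @ window z (length w) (length (w @ t)) = w @ t"
    using assms by (simp add: window_append)
  then show "window z 0 (length w) = w" "window z (length w) (length (w @ t)) = t"
    by (auto simp: append_eq_append_conv)
qed

lemma take_drop_window:
  "i + k \<le> n \<Longrightarrow> take k (drop i (window x 0 n)) = window x i (i + k)"
  by (simp add: window_def take_map drop_map)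

text \<open>\<open>M\<close> carries the finiteness of the alphabet: only finitely many words of
  length \<theta> exist, so their images have bounded length.\<close>

locale dill_rule =
  fixes \<theta> :: nat and f :: "'a list \<Rightarrow> 'a list" and M :: nat
  assumes diameter_pos: "0 < \<theta>"
    and rule_nonempty: "length u = \<theta> \<Longrightarrow> f u \<noteq> []"
    and rule_bound: "length u = \<theta> \<Longrightarrow> length (f u) \<le> M"
begin

abbreviation ext :: "'a list \<Rightarrow> 'a list" where
  "ext \<equiv> word_ext \<theta> f"

definition dill :: "(nat \<Rightarrow> 'a) \<Rightarrow> nat \<Rightarrow> 'a" where
  "dill x = inf_concat (\<lambda>i. f (window x i (i + \<theta>)))"

lemma ext_Nil [simp]: "ext [] = []"
  using diameter_pos by (simp add: word_ext_def)

lemma ext_Cons: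
  "ext (c # u) = (if \<theta> \<le> Suc (length u) then f (take \<theta> (c # u)) else []) @ ext u"
proof (cases "\<theta> \<le> length u")
  case True
  then have "[0..<length (c # u) - \<theta> + 1] = 0 # map Suc [0..<length u - \<theta> + 1]"
    by (simp add: Suc_diff_le upt_conv_Cons map_Suc_upt del: upt_Suc)
  then show ?thesis using True
    by (simp add: word_ext_def o_def del: upt_Suc)
next
  case False
  then show ?thesis using diameter_pos by (auto simp: word_ext_def)
qed

lemma length_ext_le: "length (ext u) \<le> M * length u"
proof (induction u)
  case (Cons c u)
  have "length (if \<theta> \<le> Suc (length u) then f (take \<theta> (c # u)) else []) \<le> M"
    by (auto intro: rule_bound)
  then show ?case using Cons unfolding ext_Cons length_append by simp
qed simp

lemma length_le_ext: "length u \<le> length (ext u) + \<theta>"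
proof (induction u)
  case (Cons c u)
  show ?case
  proof (cases "\<theta> \<le> Suc (length u)")
    case True
    then have "f (take \<theta> (c # u)) \<noteq> []" by (intro rule_nonempty) auto
    then have "0 < length (f (take \<theta> (c # u)))" by simp
    moreover have "length (ext (c # u)) = length (f (take \<theta> (c # u))) + length (ext u)"
      using True by (simp add: ext_Cons)
    ultimately show ?thesis using Cons unfolding list.size by linarith
  qed auto
qed simp

text \<open>\<open>ext (a @ b)\<close> consists of the images of the factors inside
  \<open>a\<close>, of those straddling the junction and of those inside \<open>b\<close>. Dropping
  the middle ones leaves \<open>ext a @ ext b\<close>.\<close>

lemma subseq_ext_append: "subseq (ext a @ ext b) (ext (a @ b))"
proof (induction a)
  case (Cons c a)
  show ?case
  proof (cases "\<theta> \<le> Suc (length a)")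
    case True
    then have "take \<theta> (c # a @ b) = take \<theta> (c # a)"
      using take_append[of \<theta> "c # a" b] by simp
    then show ?thesis using Cons True by (simp add: ext_Cons subseq_append')
  next
    case False
    then show ?thesis using Cons by (simp add: ext_Cons subseq_drop_many)
  qed
qed simp

lemma length_ext_append_ge: "length (ext a) + length (ext b) \<le> length (ext (a @ b))"
  using list_emb_length[OF subseq_ext_append[of a b]] by simp

lemma length_ext_append_le: "length (ext (a @ b)) \<le> length (ext a) + length (ext b) + \<theta> * M"
proof -
  \<comment> \<open>The minimum bounds the number of straddling factors: a new first letter
    \<open>c\<close> adds one only while \<open>c # a\<close> is shorter than \<theta>.\<close>
  have "length (ext (a @ b)) \<le> length (ext a) + length (ext b) + min (length a) \<theta> * M"
  proof (induction a)
    case (Cons c a)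
    show ?case
    proof (cases "\<theta> \<le> Suc (length a)")
      case True
      then have "take \<theta> (c # a @ b) = take \<theta> (c # a)"
        using take_append[of \<theta> "c # a" b] by simp
      then have "length (ext ((c # a) @ b)) = length (f (take \<theta> (c # a))) + length (ext (a @ b))"
        "length (ext (c # a)) = length (f (take \<theta> (c # a))) + length (ext a)"
        using True by (simp_all add: ext_Cons)
      moreover have "min (length a) \<theta> * M \<le> min (length (c # a)) \<theta> * M"
        by (intro mult_right_mono) auto
      ultimately show ?thesis using Cons by linarith
    next
      case False
      then have "length (if \<theta> \<le> Suc (length (a @ b)) then f (take \<theta> (c # a @ b)) else []) \<le> M"
        by (auto intro: rule_bound)
      then show ?thesis using Cons False by (simp add: ext_Cons)
    qed
  qed simp
  also have "\<dots> \<le> length (ext a) + length (ext b) + \<theta> * M"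
    by simp
  finally show ?thesis .
qed

lemma length_ext_snoc_le: "length (ext (a @ [c])) \<le> length (ext a) + (\<theta> + 1) * M"
  using length_ext_append_le[of a "[c]"] length_ext_le[of "[c]"] by (simp add: algebra_simps)

section \<open>Deletions and replacements in the argument\<close>

lemma levenshtein_ext_append: "levenshtein (ext (a @ b)) (ext a @ ext b) \<le> \<theta> * M"
proof -
  have "levenshtein (ext a @ ext b) (ext (a @ b)) \<le> \<theta> * M"
    using length_ext_append_le[of a b] by (intro levenshtein_subseq_le subseq_ext_append) simp
  then show ?thesis by (simp add: levenshtein_commute[of "ext (a @ b)"])
qed

text \<open>Splitting both words behind \<open>a\<close> costs two junctions of at most \<theta> * M
  each. Behind the split, \<open>c\<close> adds one image of at most \<open>M\<close>
  letters.\<close>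

lemma levenshtein_ext_delete:
  "levenshtein (ext (a @ b)) (ext (a @ c # b)) \<le> (2 * \<theta> + 1) * M"
proof -
  have "levenshtein (ext b) (ext (c # b)) \<le> M"
  proof -
    have s: "subseq (ext b) (ext (c # b))"
      by (simp add: ext_Cons subseq_drop_many)
    have "length (ext (c # b)) \<le> M + length (ext b)"
      by (auto simp: ext_Cons intro: rule_bound)
    then show ?thesis using s by (intro levenshtein_subseq_le) simp_all
  qed
  then have "levenshtein (ext a @ ext b) (ext a @ ext (c # b)) \<le> M"
    using levenshtein_append[of "ext a" "ext b" "ext a" "ext (c # b)"] by simp
  moreover have "levenshtein (ext (a @ b)) (ext a @ ext b) \<le> \<theta> * M"
    "levenshtein (ext a @ ext (c # b)) (ext (a @ c # b)) \<le> \<theta> * M"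
    using levenshtein_ext_append[of a b] levenshtein_ext_append[of a "c # b"]
    by (simp_all add: levenshtein_commute[of "ext a @ ext (c # b)"])
  ultimately show ?thesis
    using levenshtein_triangle[of "ext (a @ b)" "ext (a @ c # b)" "ext a @ ext b"]
      levenshtein_triangle[of "ext a @ ext b" "ext (a @ c # b)" "ext a @ ext (c # b)"]
    by (simp add: algebra_simps)
qed

text \<open>Letters are deleted one at a time. The prefix \<open>a\<close> takes up the kept
  letters, because putting a common letter in front may change the image of the first factor, and
  kept letters must cost nothing.\<close>

lemma levenshtein_ext_subseq:
  "subseq w u \<Longrightarrow>
   levenshtein (ext (a @ w)) (ext (a @ u)) \<le> (2 * \<theta> + 1) * M * (real (length u) - real (length w))"
proof (induction arbitrary: a rule: list_emb.induct)
  case (list_emb_Nil u)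
  show ?case
  proof (induction u arbitrary: a)
    case (Cons y u)
    have "levenshtein (ext (a @ u)) (ext (a @ y # u)) \<le> (2 * \<theta> + 1) * M"
      by (rule levenshtein_ext_delete)
    with Cons[of a] levenshtein_triangle[of "ext (a @ [])" "ext (a @ y # u)" "ext (a @ u)"]
    show ?case by (simp add: algebra_simps)
  qed simp
next
  case (list_emb_Cons w u y)
  have "levenshtein (ext (a @ u)) (ext (a @ y # u)) \<le> (2 * \<theta> + 1) * M"
    by (rule levenshtein_ext_delete)
  with list_emb_Cons.IH[of a] levenshtein_triangle[of "ext (a @ w)" "ext (a @ y # u)" "ext (a @ u)"]
  show ?case by (simp add: algebra_simps)
next
  case (list_emb_Cons2 x y w u)
  then show ?case using list_emb_Cons2.IH[of "a @ [x]"] by simp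
qed

text \<open>As the lengths agree, both words lose exactly \<open>levenshtein u v\<close> letters on
  the way to an optimal common subsequence; the two sides give the factor 2.\<close>

lemma levenshtein_ext_le:
  assumes "length u = length v"
  shows "levenshtein (ext u) (ext v) \<le> 2 * ((2 * \<theta> + 1) * M) * levenshtein u v"
proof -
  obtain w where w: "subseq w u" "subseq w v"
    "levenshtein u v = (real (length u) + real (length v)) / 2 - real (length w)"
    by (rule levenshtein_witness)
  define K where "K = real ((2 * \<theta> + 1) * M)"
  have "levenshtein u v = real (length u) - real (length w)"
    "levenshtein u v = real (length v) - real (length w)"
    using assms w(3) by simp_all
  then have "levenshtein (ext w) (ext u) \<le> K * levenshtein u v"
    "levenshtein (ext w) (ext v) \<le> K * levenshtein u v"
    unfolding K_def
    using levenshtein_ext_subseq[OF w(1), of "[]"] levenshtein_ext_subseq[OF w(2), of "[]"] by simp_all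
  moreover have "levenshtein (ext u) (ext v) \<le> levenshtein (ext w) (ext u) + levenshtein (ext w) (ext v)"
    using levenshtein_triangle[of "ext u" "ext v" "ext w"] by (simp add: levenshtein_commute[of "ext u"])
  ultimately have "levenshtein (ext u) (ext v) \<le> 2 * K * levenshtein u v"
    by linarith
  then show ?thesis by (simp add: K_def)
qed

text \<open>A factor of length \<theta> that starts in \<open>a\<close> ends inside
  \<open>a @ r\<close>, so \<open>a\<close> contributes the same with and without \<open>t\<close>.
  Unlike the estimates for concatenations, this is exact.\<close>

lemma length_ext_overlap:
  assumes "\<theta> \<le> length r"
  shows "length (ext (a @ r @ t)) + length (ext r) = length (ext (a @ r)) + length (ext (r @ t))"
proof (induction a)
  case (Cons c a)
  have "take \<theta> (c # a @ r @ t) = take \<theta> (c # a @ r)"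
    using assms take_append[of \<theta> "c # a @ r" t] by simp
  then show ?case using assms Cons by (simp add: ext_Cons)
qed simp

text \<open>A factor of length \<theta> that is not inside the replaced word meets only its first or
  only its last \<theta> letters, and these are the same in \<open>u\<close> and \<open>v\<close>.
  The proof cuts at the common prefix \<open>q\<close> and the common suffix
  \<open>r\<close>.\<close>

lemma length_ext_replace:
  assumes "\<theta> \<le> length u" "length v = length u"
    and "take \<theta> u = take \<theta> v" "drop (length u - \<theta>) u = drop (length u - \<theta>) v"
  shows "length (ext (s @ v @ t)) + length (ext u) = length (ext (s @ u @ t)) + length (ext v)"
proof -
  define r where "r = drop (length u - \<theta>) u"
  define q where "q = take \<theta> u"
  have r: "\<theta> \<le> length r" and q: "\<theta> \<le> length q" using assms by (auto simp: r_def q_def)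
  have u: "u = take (length u - \<theta>) u @ r" and v: "v = take (length u - \<theta>) v @ r"
    unfolding r_def using append_take_drop_id[of "length u - \<theta>" v]
    by (simp, simp add: assms(4))
  have u': "u = q @ drop \<theta> u" and v': "v = q @ drop \<theta> v"
    unfolding q_def by (simp, simp only: append_take_drop_id assms(3))
  have 1: "length (ext (w @ t)) + length (ext r) = length (ext w) + length (ext (r @ t))"
    if "w = w' @ r" for w w'
    using length_ext_overlap[OF r, of w' t] that by simp
  have 2: "length (ext (s @ w @ t)) + length (ext q) = length (ext (s @ q)) + length (ext (w @ t))"
    if "w = q @ w'" for w w'
    using length_ext_overlap[OF q, of s "w' @ t"] that by simp
  from 1[OF u] 1[OF v] 2[OF u'] 2[OF v'] show ?thesis by linarith
qed

section \<open>Factors of the image of a point\<close>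

lemma window_dill_prefix: "window (dill x) 0 (length (ext (window x 0 n))) = ext (window x 0 n)"
proof (cases "\<theta> \<le> n")
  case True
  have "map (\<lambda>i. f (take \<theta> (drop i (window x 0 n)))) [0..<n - \<theta> + 1]
      = map (\<lambda>i. f (window x i (i + \<theta>))) [0..<n - \<theta> + 1]"
    using True by (intro map_cong refl) (simp add: take_drop_window del: upt_Suc)
  then have "ext (window x 0 n) = concat (map (\<lambda>i. f (window x i (i + \<theta>))) [0..<n - \<theta> + 1])"
    using True unfolding word_ext_def by (simp only: length_window if_True diff_zero)
  then show ?thesis
    unfolding dill_def using window_inf_concat[of "\<lambda>i. f (window x i (i + \<theta>))" "n - \<theta> + 1"]
    by (simp add: rule_nonempty)
next
  case False
  then show ?thesis by (simp add: word_ext_def window_def)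
qed

text \<open>Behind \<open>ext w\<close>, the word \<open>ext (w @ t)\<close> contains
  \<open>ext t\<close> and, in addition, only the images of the factors straddling the
  junction.\<close>

lemma dill_factor:
  assumes "window z 0 (length (w @ t)) = w @ t"
  shows "subseq (ext t) (window (dill z) (length (ext w)) (length (ext (w @ t))))"
    and "levenshtein (window (dill z) (length (ext w)) (length (ext (w @ t)))) (ext t) \<le> \<theta> * M"
proof -
  let ?R = "window (dill z) (length (ext w)) (length (ext (w @ t)))"
  have "window (dill z) 0 (length (ext w)) = ext w"
    using window_dill_prefix[of z "length w"] window_prefixD(1)[OF assms] by simp
  moreover have "window (dill z) 0 (length (ext (w @ t))) = ext (w @ t)"
    using window_dill_prefix[of z "length (w @ t)"] assms by simp
  moreover have le: "length (ext w) \<le> length (ext (w @ t))"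
    using length_ext_append_ge[of w t] by simp
  ultimately have "ext w @ ?R = ext (w @ t)"
    using window_append[of 0 "length (ext w)" "length (ext (w @ t))" "dill z"] by simp
  then have "subseq (ext w @ ext t) (ext w @ ?R)"
    using subseq_ext_append[of w t] by simp
  then show sub: "subseq (ext t) ?R" by (simp add: subseq_append')
  have "length ?R \<le> length (ext t) + \<theta> * M"
    using length_ext_append_le[of w t] by simp
  then show "levenshtein ?R (ext t) \<le> \<theta> * M"
    unfolding levenshtein_commute[of ?R] by (intro levenshtein_subseq_le sub)
qed

abbreviation pos :: "(nat \<Rightarrow> 'a) \<Rightarrow> nat \<Rightarrow> nat" where
  "pos x n \<equiv> length (ext (window x 0 n))"

lemma pos_mono: "i \<le> j \<Longrightarrow> pos x i \<le> pos x j"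
  using length_ext_append_ge[of "window x 0 i" "window x i j"] by (simp add: window_append)

lemma dill_window_factor:
  assumes "i \<le> j"
  shows "subseq (ext (window x i j)) (window (dill x) (pos x i) (pos x j))"
    and "levenshtein (window (dill x) (pos x i) (pos x j)) (ext (window x i j)) \<le> \<theta> * M"
  using dill_factor[of x "window x 0 i" "window x i j"] assms by (simp_all add: window_append)

text \<open>An approximate inverse of \<open>pos x\<close>, which translates positions of the image
  into positions of the argument.\<close>

definition idx :: "(nat \<Rightarrow> 'a) \<Rightarrow> nat \<Rightarrow> nat" where
  "idx x k = (LEAST i. k \<le> pos x i)"

lemma ex_pos_ge: "\<exists>i. k \<le> pos x i"
  using length_le_ext[of "window x 0 (k + \<theta>)"] by auto

text \<open>By minimality the prefix shorter by one letter does not reach \<open>k\<close>, and one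
  letter lengthens the image by at most \<open>(\<theta> + 1) * M\<close>.\<close>

lemma pos_idx: "k \<le> pos x (idx x k)" "pos x (idx x k) \<le> k + (\<theta> + 1) * M"
proof -
  show "k \<le> pos x (idx x k)"
    unfolding idx_def using ex_pos_ge by (rule LeastI_ex)
  show "pos x (idx x k) \<le> k + (\<theta> + 1) * M"
  proof (cases "idx x k")
    case 0
    then show ?thesis by (simp add: window_def)
  next
    case (Suc i)
    then have "\<not> k \<le> pos x i" unfolding idx_def by (metis lessI not_less_Least)
    moreover have "window x 0 (Suc i) = window x 0 i @ [x i]" by (simp add: window_def)
    ultimately show ?thesis using length_ext_snoc_le[of "window x 0 i" "x i"] Suc by simp
  qed
qed

lemma idx_mono: "k \<le> l \<Longrightarrow> idx x k \<le> idx x l"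
  unfolding idx_def[of x k] using pos_idx(1)[of l x] by (intro Least_le) simp

section \<open>Diamond-uniform rules\<close>

text \<open>Surrounding both words by the same word of length \<theta> makes the diamond condition
  applicable; the two junctions cost at most \<theta> * M each. Here \<open>undefined\<close> is
  just some fixed letter.\<close>

lemma diamond_uniform_length:
  assumes "diamond_uniform \<theta> f" "length u = length v"
  shows "length (ext u) \<le> length (ext v) + 2 * (\<theta> * M)"
proof -
  define p :: "'a list" where "p = replicate \<theta> undefined"
  have "length (ext (p @ u @ p)) = length (ext (p @ v @ p))"
    using assms(1)[unfolded diamond_uniform_def, rule_format, of "\<theta> + length u + \<theta>"
        "p @ u @ p" "p @ v @ p"] assms(2) by (simp add: p_def)
  moreover have "length (ext p) + (length (ext u) + length (ext p)) \<le> length (ext (p @ u @ p))"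
    using length_ext_append_ge[of p "u @ p"] length_ext_append_ge[of u p] by linarith
  moreover have "length (ext (p @ v @ p))
      \<le> length (ext p) + (length (ext v) + length (ext p) + \<theta> * M) + \<theta> * M"
    using length_ext_append_le[of p "v @ p"] length_ext_append_le[of v p] by linarith
  ultimately show ?thesis by linarith
qed

lemma diamond_uniform_W_L:
  assumes "diamond_uniform \<theta> f" and W: "W_L x y = 0"
  shows "W_L (dill x) (dill y) = 0"
  unfolding W_L_eq_0_iff[of "dill x"]
proof (intro allI impI)
  fix e :: real assume e: "e > 0"
  define T where "T = \<theta> * M"
  define c where "c = (\<theta> + 1) * M"
  define K where "K = 2 * ((2 * \<theta> + 1) * M)"
  define e' where "e' = e / (real K + 1)"
  have e': "e' > 0" and Ke': "real K * e' \<le> e"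
    using e by (auto simp: e'_def field_simps)
  obtain C where C: "\<And>k l. levenshtein (window x k (k + l)) (window y k (k + l)) \<le> e' * real l + C"
    using W e' unfolding W_L_eq_0_iff by blast
  show "\<exists>C. \<forall>k l. levenshtein (window (dill x) k (k + l)) (window (dill y) k (k + l)) \<le> e * real l + C"
  proof (intro exI allI)
    fix k l
    \<comment> \<open>The factor of \<open>x\<close> from \<open>i\<close> to \<open>j\<close>
      produces the window at \<open>k\<close> up to bounded errors at both ends. By the bound
      \<open>u\<close> below, the same \<open>i\<close> and \<open>j\<close> serve for
      \<open>y\<close>.\<close>
    define i where "i = idx x k"
    define j where "j = idx x (k + l)"
    have ij: "i \<le> j" unfolding i_def j_def by (rule idx_mono) simp
    have pi: "k \<le> pos x i" "pos x i \<le> k + c" and pj: "k + l \<le> pos x j" "pos x j \<le> k + l + c"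
      unfolding i_def j_def c_def by (rule pos_idx)+
    have u: "pos x n \<le> pos y n + 2 * T" "pos y n \<le> pos x n + 2 * T" for n
      unfolding T_def using assms(1) by (intro diamond_uniform_length; simp)+
    have s: "subseq (ext (window x i j)) (window (dill x) (pos x i) (pos x j))"
      using ij by (rule dill_window_factor)
    \<comment> \<open>Images of factors are nonempty, so \<open>j - i\<close> exceeds
      \<open>l\<close> by at most a constant.\<close>
    have "length (window x i j) \<le> length (ext (window x i j)) + \<theta>"
      by (rule length_le_ext)
    also have "length (ext (window x i j)) \<le> pos x j - pos x i"
      using list_emb_length[OF s] by simp
    finally have "j - i \<le> l + (c + \<theta>)" using pi pj ij by simp
    then have ji: "real (j - i) \<le> real l + real (c + \<theta>)" by linarith
    \<comment> \<open>The path runs through \<open>?Fx\<close>, \<open>?Gx\<close>,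
      \<open>?Ex\<close>, \<open>?Ey\<close>, \<open>?Gy\<close>, \<open>?Fy\<close>. Only the step
      from \<open>?Ex\<close> to \<open>?Ey\<close> has a cost that grows with
      \<open>l\<close>.\<close>
    let ?Fx = "window (dill x) k (k + l)" and ?Fy = "window (dill y) k (k + l)"
      and ?Gx = "window (dill x) (pos x i) (pos x j)" and ?Gy = "window (dill y) (pos y i) (pos y j)"
      and ?Ex = "ext (window x i j)" and ?Ey = "ext (window y i j)"
    have "2 * levenshtein ?Fx ?Gx \<le> \<bar>real k - real (pos x i)\<bar> + \<bar>real (k + l) - real (pos x j)\<bar>"
      using ij by (intro levenshtein_windows pos_mono) auto
    moreover have "\<bar>real k - real (pos x i)\<bar> \<le> real c" "\<bar>real (k + l) - real (pos x j)\<bar> \<le> real c"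
      using pi pj by linarith+
    ultimately have 1: "levenshtein ?Fx ?Gx \<le> real c" by linarith
    have "2 * levenshtein ?Gy ?Fy \<le> \<bar>real (pos y i) - real k\<bar> + \<bar>real (pos y j) - real (k + l)\<bar>"
      using ij by (intro levenshtein_windows pos_mono) auto
    moreover have "\<bar>real (pos y i) - real k\<bar> \<le> real c + 2 * real T"
      "\<bar>real (pos y j) - real (k + l)\<bar> \<le> real c + 2 * real T"
      using pi pj u[of i] u[of j] by linarith+
    ultimately have 2: "levenshtein ?Gy ?Fy \<le> real c + 2 * real T" by linarith
    have 3: "levenshtein ?Gx ?Ex \<le> real T"
      unfolding T_def using ij by (rule dill_window_factor)
    have 4: "levenshtein ?Ey ?Gy \<le> real T"
      unfolding T_def levenshtein_commute[of ?Ey] using ij by (rule dill_window_factor)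
    have "levenshtein ?Ex ?Ey \<le> real K * levenshtein (window x i j) (window y i j)"
      unfolding K_def by (rule levenshtein_ext_le) simp
    also have "\<dots> \<le> real K * (e' * real (j - i) + C)"
      using C[of i "j - i"] ij by (intro mult_left_mono) auto
    also have "\<dots> = (real K * e') * real (j - i) + real K * C" by (simp add: algebra_simps)
    also have "(real K * e') * real (j - i) \<le> e * (real l + real (c + \<theta>))"
      using Ke' ji e by (intro mult_mono) auto
    finally have 5: "levenshtein ?Ex ?Ey \<le> e * real l + (e * real (c + \<theta>) + real K * C)"
      by (simp add: algebra_simps)
    have "levenshtein ?Fx ?Fy \<le> levenshtein ?Fx ?Gx + levenshtein ?Gx ?Ex + levenshtein ?Ex ?Ey
        + levenshtein ?Ey ?Gy + levenshtein ?Gy ?Fy"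
      using levenshtein_triangle[of ?Fx ?Fy ?Gx] levenshtein_triangle[of ?Gx ?Fy ?Ex]
        levenshtein_triangle[of ?Ex ?Fy ?Ey] levenshtein_triangle[of ?Ey ?Fy ?Gy] by linarith
    with 1 2 3 4 5 show "levenshtein ?Fx ?Fy
        \<le> e * real l + (2 * real c + 4 * real T + (e * real (c + \<theta>) + real K * C))"
      by linarith
  qed
qed

end

section \<open>Sparse replacements\<close>

text \<open>Completing the square yields the constant. A linear bound on \<open>t * t - t\<close>
  thus becomes a bound on \<open>t\<close> of arbitrarily small slope.\<close>

lemma le_quadratic:
  fixes t d :: real
  assumes "d > 0"
  shows "t \<le> d * (t * t - t) + (1 + d)\<^sup>2 / (4 * d)"
proof -
  have "d * (t * t - t) + (1 + d)\<^sup>2 / (4 * d) - t = (2 * d * t - (1 + d))\<^sup>2 / (4 * d)"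
    using assms by (simp add: field_simps power2_eq_square)
  moreover have "(2 * d * t - (1 + d))\<^sup>2 / (4 * d) \<ge> 0"
    using assms by simp
  ultimately show ?thesis by linarith
qed

text \<open>The points differ at most in the \<open>L\<close> positions from each \<open>e n\<close>
  on. The gaps between these starts grow at least linearly, so the number of differences in a window
  is sublinear and bounds the distance.\<close>

lemma W_L_sparse_replacement:
  assumes len: "length u = length v" and u: "u \<noteq> []" and G: "\<And>n. n \<le> length (G n)"
  shows "W_L (inf_concat (\<lambda>n. u @ G n)) (inf_concat (\<lambda>n. v @ G n)) = 0"
proof -
  define L where "L = length u"
  define z where "z = inf_concat (\<lambda>n. u @ G n)"
  define z' where "z' = inf_concat (\<lambda>n. v @ G n)"
  define S where "S n = concat (map (\<lambda>n. u @ G n) [0..<n])" for n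
  define S' where "S' n = concat (map (\<lambda>n. v @ G n) [0..<n])" for n
  define e where "e n = length (S n)" for n
  have L: "0 < L" using u by (simp add: L_def)
  have v: "v \<noteq> []" using len u by auto
  have S_Suc: "S (Suc n) = S n @ u @ G n" "S' (Suc n) = S' n @ v @ G n" for n
    by (simp_all add: S_def S'_def)
  have e': "length (S' n) = e n" for n
    by (induction n) (simp_all add: e_def S_Suc len, simp_all add: S_def S'_def)
  have e_Suc: "e (Suc n) = e n + L + length (G n)" for n
    by (simp add: e_def S_Suc L_def)
  have e_ge: "n \<le> e n" for n
  proof (induction n)
    case (Suc n)
    then show ?case using L by (simp add: e_Suc)
  qed simp
  have nth: "z i = S n ! i" "z' i = S' n ! i" if "i < e n" for i n
  proof -
    have "window z 0 (e n) = S n"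
      unfolding z_def e_def S_def by (rule window_inf_concat) (simp add: u)
    moreover have "window z' 0 (e n) = S' n"
      unfolding z'_def e'[symmetric] S'_def by (rule window_inf_concat) (simp add: v)
    moreover have "window z 0 (e n) ! i = z i" "window z' 0 (e n) ! i = z' i"
      using that by (simp_all add: window_def)
    ultimately show "z i = S n ! i" "z' i = S' n ! i" by simp_all
  qed
  have diff: "\<exists>n. e n \<le> i \<and> i < e n + L" if "z i \<noteq> z' i" for i
  proof -
    \<comment> \<open>Position \<open>i\<close> lies in block \<open>m - 1\<close>; behind the
      leading \<open>u\<close> or \<open>v\<close> both points show the same letter of
      \<open>G n\<close>.\<close>
    define m where "m = (LEAST m. i < e m)"
    have "i < e (Suc i)" using e_ge[of "Suc i"] by simp
    then have m: "i < e m" unfolding m_def by (rule LeastI)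
    then obtain n where n: "m = Suc n" by (cases m) (auto simp: e_def S_def)
    then have "\<not> i < e n" unfolding m_def by (metis lessI not_less_Least)
    moreover have False if "e n + L \<le> i"
    proof -
      have i: "\<not> i < e n" "\<not> i - e n < L" using that L by auto
      have "z i = G n ! (i - e n - L)"
        using nth(1)[OF m] i by (simp add: n S_Suc nth_append e_def L_def)
      moreover have "z' i = G n ! (i - e n - L)"
        using nth(2)[OF m] i by (simp add: n S_Suc nth_append e' L_def flip: len)
      ultimately show False using \<open>z i \<noteq> z' i\<close> by simp
    qed
    ultimately show ?thesis by (meson not_less)
  qed
  \<comment> \<open>Gap number \<open>n + s\<close> is at least \<open>s\<close>. Summing over
    \<open>s < t\<close> gives \<open>t * (t - 1) / 2\<close>, stated doubled and without
    subtraction.\<close>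
  have growth: "2 * e n + t * t \<le> 2 * e (n + t) + t" for n t
  proof (induction t)
    case (Suc t)
    have "e (n + t) + (n + t) \<le> e (n + Suc t)" using e_Suc[of "n + t"] G[of "n + t"] by simp
    with Suc show ?case by simp
  qed simp
  have card: "\<exists>t. card {i. k \<le> i \<and> i < k + l \<and> z i \<noteq> z' i} \<le> (t + 1) * L \<and> t * t \<le> t + 2 * (l + L)"
    for k l
  proof -
    \<comment> \<open>The blocks whose replaced word meets the window. They lie among
      \<open>t + 1\<close> consecutive blocks whose outer starts are less than \<open>l + L\<close>
      apart, so \<open>growth\<close> bounds \<open>t\<close>.\<close>
    define N where "N = {n. k < e n + L \<and> e n < k + l}"
    have fin: "finite N"
    proof (rule finite_subset)
      show "N \<subseteq> {..<k + l}" using e_ge by (auto simp: N_def intro: le_less_trans)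
    qed simp
    have sub: "{i. k \<le> i \<and> i < k + l \<and> z i \<noteq> z' i} \<subseteq> (\<Union>n\<in>N. {e n..<e n + L})"
    proof
      fix i assume "i \<in> {i. k \<le> i \<and> i < k + l \<and> z i \<noteq> z' i}"
      then have i: "k \<le> i" "i < k + l" "z i \<noteq> z' i" by auto
      with diff obtain n where "e n \<le> i" "i < e n + L" by blast
      with i show "i \<in> (\<Union>n\<in>N. {e n..<e n + L})" by (intro UN_I[of n]) (auto simp: N_def)
    qed
    show ?thesis
    proof (cases "N = {}")
      case True
      then have "{i. k \<le> i \<and> i < k + l \<and> z i \<noteq> z' i} = {}" using sub by simp
      then show ?thesis by (metis card.empty le0 mult_zero_left)
    next
      case False
      define m where "m = Min N"
      define t where "t = Max N - m"
      have mN: "m \<in> N" "Max N \<in> N" unfolding m_def using fin False by (auto intro: Min_in Max_in)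
      have mt: "m + t = Max N" unfolding t_def m_def using fin False by (simp add: Min_le_iff)
      have N: "N \<subseteq> {m..m + t}" unfolding mt using fin by (auto simp: m_def)
      have "card {i. k \<le> i \<and> i < k + l \<and> z i \<noteq> z' i} \<le> card (\<Union>n\<in>N. {e n..<e n + L})"
        using sub fin by (intro card_mono) auto
      also have "\<dots> \<le> (\<Sum>n\<in>N. card {e n..<e n + L})" using fin by (rule card_UN_le)
      also have "\<dots> = card N * L" by simp
      also have "\<dots> \<le> card {m..m + t} * L" using N by (intro mult_right_mono card_mono) auto
      finally have "card {i. k \<le> i \<and> i < k + l \<and> z i \<noteq> z' i} \<le> (t + 1) * L" by simp
      moreover have "e (m + t) < k + l" "k < e m + L" using mN by (auto simp: N_def mt)
      then have "e (m + t) \<le> e m + (l + L)" by simp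
      then have "t * t \<le> t + 2 * (l + L)" using growth[of m t] by simp
      ultimately show ?thesis by blast
    qed
  qed
  have "W_L z z' = 0"
    unfolding W_L_eq_0_iff
  proof (intro allI impI)
    fix \<epsilon> :: real assume eps: "\<epsilon> > 0"
    \<comment> \<open>Chosen so that \<open>d * (2 * (l + L)) * L\<close> equals
      \<open>\<epsilon> * (l + L)\<close>.\<close>
    define d where "d = \<epsilon> / (2 * L)"
    define C where "C = (1 + d)\<^sup>2 / (4 * d)"
    have d: "d > 0" using eps L by (simp add: d_def)
    show "\<exists>C. \<forall>k l. levenshtein (window z k (k + l)) (window z' k (k + l)) \<le> \<epsilon> * real l + C"
    proof (intro exI allI)
      fix k l
      obtain t where t: "card {i. k \<le> i \<and> i < k + l \<and> z i \<noteq> z' i} \<le> (t + 1) * L"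
        "t * t \<le> t + 2 * (l + L)" using card by blast
      have "real (t * t) \<le> real (t + 2 * (l + L))" using t(2) by (simp only: of_nat_le_iff)
      then have "real t * real t - real t \<le> 2 * (real l + real L)" by simp
      then have "d * (real t * real t - real t) \<le> d * (2 * (real l + real L))"
        using d by (intro mult_left_mono) auto
      then have "real t \<le> d * (2 * (real l + real L)) + C"
        using le_quadratic[OF d, of "real t"] unfolding C_def by linarith
      then have "(real t + 1) * real L \<le> (d * (2 * (real l + real L)) + C + 1) * real L"
        by (intro mult_right_mono) auto
      also have "\<dots> = \<epsilon> * real l + (\<epsilon> * real L + (C + 1) * real L)"
        using L by (simp add: d_def field_simps)
      finally have "(real t + 1) * real L \<le> \<epsilon> * real l + (\<epsilon> * real L + (C + 1) * real L)" .
      moreover have "real (card {i. k \<le> i \<and> i < k + l \<and> z i \<noteq> z' i}) \<le> real ((t + 1) * L)"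
        using t(1) by (simp only: of_nat_le_iff)
      ultimately show "levenshtein (window z k (k + l)) (window z' k (k + l))
          \<le> \<epsilon> * real l + (\<epsilon> * real L + (C + 1) * real L)"
        using levenshtein_le_hamming[of z k l z'] by (simp add: algebra_simps)
    qed
  qed
  then show ?thesis by (simp add: z_def z'_def)
qed

section \<open>Rules that are not diamond-uniform\<close>

text \<open>The maximum is attained because twice the distance is a natural number of size at most
  \<open>2 * n\<close>.\<close>

lemma levenshtein_max_shift:
  "\<exists>k. \<forall>k'. levenshtein (window x k' (k' + n)) (window y k' (k' + n))
      \<le> levenshtein (window x k (k + n)) (window y k (k + n))"
proof -
  have "\<exists>m::nat. 2 * levenshtein (window x k (k + n)) (window y k (k + n)) = real m" for k
    by (simp add: levenshtein_def)
  then obtain g :: "nat \<Rightarrow> nat" where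
    g: "\<And>k. 2 * levenshtein (window x k (k + n)) (window y k (k + n)) = real (g k)" by metis
  have b: "g k \<le> 2 * n" for k
    using g[of k] levenshtein_le_length[of "window x k (k + n)" "window y k (k + n)"] by simp
  have "\<exists>k. True \<and> (\<forall>k'. True \<longrightarrow> g k' \<le> g k)"
    by (rule ex_has_greatest_nat[of _ 0 _ "Suc (2 * n)"]) (use b in \<open>auto simp: less_Suc_eq_le\<close>)
  then obtain k where k: "\<And>k'. g k' \<le> g k" by blast
  have "levenshtein (window x k' (k' + n)) (window y k' (k' + n))
      \<le> levenshtein (window x k (k + n)) (window y k (k + n))" for k'
    using g[of k] g[of k'] k[of k'] by linarith
  then show ?thesis by blast
qed

context dill_rule
begin

text \<open>Each further letter lengthens the image by at most \<open>(\<theta> + 1) * M\<close>,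
  which bounds the overshoot when \<Delta> is first reached.\<close>

lemma ex_padding:
  assumes "length (ext w) \<le> \<Delta>"
  shows "\<exists>m. \<Delta> \<le> length (ext (w @ replicate m a)) \<and>
             length (ext (w @ replicate m a)) \<le> \<Delta> + (\<theta> + 1) * M"
proof -
  let ?P = "\<lambda>m. \<Delta> \<le> length (ext (w @ replicate m a))"
  have "?P (\<Delta> + \<theta>)" using length_le_ext[of "w @ replicate (\<Delta> + \<theta>) a"] by simp
  then have P: "?P (LEAST m. ?P m)" by (rule LeastI)
  show ?thesis
  proof (cases "LEAST m. ?P m")
    case 0
    then show ?thesis using P assms by (intro exI[of _ 0]) simp
  next
    case (Suc m)
    then have "\<not> ?P m" by (metis (no_types, lifting) lessI not_less_Least)
    moreover have "w @ replicate (Suc m) a = (w @ replicate m a) @ [a]"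
      by (simp add: replicate_append_same)
    ultimately have "length (ext (w @ replicate (Suc m) a)) \<le> \<Delta> + (\<theta> + 1) * M"
      using length_ext_snoc_le[of "w @ replicate m a" a] by simp
    then show ?thesis using P Suc by metis
  qed
qed

text \<open>Each replacement changes the length by the same amount. The tail \<open>t\<close> is
  general so that it can hold the last block while the earlier ones are replaced.\<close>

lemma length_ext_shift:
  assumes "\<theta> \<le> length u" "length v = length u"
    and "take \<theta> u = take \<theta> v" "drop (length u - \<theta>) u = drop (length u - \<theta>) v"
  shows "length (ext (concat (map (\<lambda>n. v @ G n) [0..<n]) @ t)) + n * length (ext u)
       = length (ext (concat (map (\<lambda>n. u @ G n) [0..<n]) @ t)) + n * length (ext v)"
proof (induction n arbitrary: t)
  case (Suc n)
  from Suc[of "v @ G n @ t"]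
    length_ext_replace[OF assms, of "concat (map (\<lambda>n. u @ G n) [0..<n])" "G n @ t"]
  show ?case by simp
qed simp

text \<open>In block \<open>n\<close> the image of the second point is shifted by \<open>\<Delta> n\<close> with respect to the
  image of the first; the padding makes the image of \<open>X\<close> in the second point face the image
  of \<open>Y\<close> in the first.\<close>

lemma levenshtein_ext_sublinear:
  assumes pres: "\<And>x y. W_L x y = 0 \<Longrightarrow> W_L (dill x) (dill y) = 0"
    and uv: "\<theta> \<le> length u" "length v = length u"
      "take \<theta> u = take \<theta> v" "drop (length u - \<theta>) u = drop (length u - \<theta>) v"
    and less: "length (ext u) < length (ext v)"
    and X: "\<And>n. length (ext (X n)) \<le> n + b" "\<And>n. n \<le> length (ext (X n)) + b"
    and Y: "\<And>n. length (ext (Y n)) \<le> n + b" "\<And>n. n \<le> length (ext (Y n)) + b"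
    and eps: "\<epsilon> > 0"
  shows "\<exists>C. \<forall>n. levenshtein (ext (X n)) (ext (Y n)) \<le> \<epsilon> * real n + C"
proof -
  define T where "T = \<theta> * M"
  define c where "c = (\<theta> + 1) * M"
  \<comment> \<open>Before \<open>G n\<close> begins, \<open>n + 1\<close> words have been
    replaced.\<close>
  define \<Delta> where "\<Delta> n = Suc n * (length (ext v) - length (ext u))" for n
  have \<Delta>_ge: "n \<le> \<Delta> n" for n
  proof -
    have "Suc n * 1 \<le> \<Delta> n" unfolding \<Delta>_def using less by (intro mult_left_mono) auto
    then show ?thesis by simp
  qed
  \<comment> \<open>Block \<open>n\<close> hosts the words of index \<open>n - b\<close>: the image
    of \<open>X (n - b)\<close> has at most \<open>n\<close> letters, hence at most
    \<open>\<Delta> n\<close>, so padding can bring it to that length up to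
    \<open>c\<close>.\<close>
  have "\<exists>m. b \<le> n \<longrightarrow> \<Delta> n \<le> length (ext (X (n - b) @ replicate m undefined)) \<and>
      length (ext (X (n - b) @ replicate m undefined)) \<le> \<Delta> n + c" for n
  proof (cases "b \<le> n")
    case True
    then have "length (ext (X (n - b))) \<le> \<Delta> n"
      using X(1)[of "n - b"] \<Delta>_ge[of n] by simp
    from ex_padding[OF this] show ?thesis unfolding c_def by blast
  qed simp
  then obtain m where m: "\<And>n. b \<le> n \<Longrightarrow> \<Delta> n \<le> length (ext (X (n - b) @ replicate (m n) undefined))"
    "\<And>n. b \<le> n \<Longrightarrow> length (ext (X (n - b) @ replicate (m n) undefined)) \<le> \<Delta> n + c"
    by metis
  define R where "R n = X (n - b) @ replicate (m n) undefined" for n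
  \<comment> \<open>The final padding ensures \<open>n \<le> length (G n)\<close>, which makes the
    replacements sparse.\<close>
  define G where "G n = R n @ Y (n - b) @ replicate n undefined" for n
  define z where "z = inf_concat (\<lambda>n. u @ G n)"
  define z' where "z' = inf_concat (\<lambda>n. v @ G n)"
  define S where "S n = concat (map (\<lambda>n. u @ G n) [0..<n])" for n
  define S' where "S' n = concat (map (\<lambda>n. v @ G n) [0..<n])" for n
  have ne: "u \<noteq> []" "v \<noteq> []" using uv diameter_pos by auto
  have z: "window z 0 (length (S n)) = S n" for n
    unfolding z_def S_def by (rule window_inf_concat) (simp add: ne)
  have z': "window z' 0 (length (S' n)) = S' n" for n
    unfolding z'_def S'_def by (rule window_inf_concat) (simp add: ne)
  have "W_L z z' = 0"
    unfolding z_def z'_def using uv(2) ne by (intro W_L_sparse_replacement) (simp_all add: G_def)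
  then have "W_L (dill z) (dill z') = 0" by (rule pres)
  then obtain C where C: "\<And>k l. levenshtein (window (dill z) k (k + l)) (window (dill z') k (k + l))
      \<le> \<epsilon> * real l + C"
    using eps unfolding W_L_eq_0_iff by blast
  show ?thesis
  proof (intro exI allI)
    fix N
    define n where "n = N + b"
    define A where "A = S n @ u"
    define A' where "A' = S' n @ v"
    define B where "B = A @ R n"
    have S_Suc: "S (Suc n) = (B @ Y N) @ replicate n undefined"
      "S' (Suc n) = (A' @ X N) @ replicate (m n) undefined @ Y N @ replicate n undefined"
      by (simp_all add: S_def S'_def B_def A_def A'_def G_def R_def n_def)
    have wz: "window z 0 (length (B @ Y N)) = B @ Y N"
      by (rule window_prefixD(1)[OF z[of "Suc n", unfolded S_Suc(1)]])
    have wz': "window z' 0 (length (A' @ X N)) = A' @ X N"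
      by (rule window_prefixD(1)[OF z'[of "Suc n", unfolded S_Suc(2)]])
    \<comment> \<open>Up to a junction, the image of \<open>X N\<close> starts at \<open>Q\<close>
      in \<open>dill z'\<close> and that of \<open>Y N\<close> at \<open>P\<close> in
      \<open>dill z\<close>. The choice of \<open>R n\<close> keeps \<open>P\<close> close to
      \<open>Q\<close>, so both are compared with the windows from \<open>Q\<close> to
      \<open>Q + N\<close>.\<close>
    define Q where "Q = length (ext A')"
    define Q' where "Q' = length (ext (A' @ X N))"
    define P where "P = length (ext B)"
    define P' where "P' = length (ext (B @ Y N))"
    have "length (ext A') + Suc n * length (ext u) = length (ext A) + Suc n * length (ext v)"
      \<comment> \<open>The first fact treats the \<open>n\<close> complete blocks, the second the
        word that opens block \<open>n\<close>.\<close>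
      using length_ext_shift[OF uv, of G n v] length_ext_replace[OF uv, of "S n" "[]"]
      by (simp add: A_def A'_def S_def S'_def)
    moreover have "\<Delta> n + Suc n * length (ext u) = Suc n * length (ext v)"
      unfolding \<Delta>_def using less by (simp add: diff_mult_distrib2 del: mult_Suc)
    ultimately have Q: "Q = length (ext A) + \<Delta> n" unfolding Q_def by linarith
    have "length (ext A) + length (ext (R n)) \<le> P" "P \<le> length (ext A) + length (ext (R n)) + T"
      unfolding P_def B_def T_def by (rule length_ext_append_ge length_ext_append_le)+
    moreover have "\<Delta> n \<le> length (ext (R n))" "length (ext (R n)) \<le> \<Delta> n + c"
      unfolding R_def using m[of n] by (simp_all add: n_def)
    ultimately have P: "Q \<le> P" "P \<le> Q + c + T" using Q by linarith+
    have "P + length (ext (Y N)) \<le> P'" "P' \<le> P + length (ext (Y N)) + T"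
      unfolding P_def P'_def T_def by (rule length_ext_append_ge length_ext_append_le)+
    with P Y[of N] have P': "Q + N \<le> P' + b" "P' \<le> Q + N + c + 2 * T + b" and PP': "P \<le> P'"
      by linarith+
    have "Q + length (ext (X N)) \<le> Q'" "Q' \<le> Q + length (ext (X N)) + T"
      unfolding Q_def Q'_def T_def by (rule length_ext_append_ge length_ext_append_le)+
    with X[of N] have Q': "Q + N \<le> Q' + b" "Q' \<le> Q + N + T + b" and QQ': "Q \<le> Q'"
      by linarith+
    let ?WX = "window (dill z') Q Q'" and ?VX = "window (dill z') Q (Q + N)"
      and ?WY = "window (dill z) P P'" and ?VY = "window (dill z) Q (Q + N)"
    have 1: "levenshtein (ext (X N)) ?WX \<le> real T"
      unfolding levenshtein_commute[of "ext (X N)"] T_def Q_def Q'_def using wz' by (rule dill_factor(2))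
    have 5: "levenshtein ?WY (ext (Y N)) \<le> real T"
      unfolding T_def P_def P'_def using wz by (rule dill_factor(2))
    have "2 * levenshtein ?WX ?VX \<le> \<bar>real Q - real Q\<bar> + \<bar>real Q' - real (Q + N)\<bar>"
      using QQ' by (intro levenshtein_windows) auto
    moreover have "\<bar>real Q' - real (Q + N)\<bar> \<le> real T + real b" using Q' by linarith
    ultimately have 2: "2 * levenshtein ?WX ?VX \<le> real T + real b" by linarith
    have "2 * levenshtein ?VY ?WY \<le> \<bar>real Q - real P\<bar> + \<bar>real (Q + N) - real P'\<bar>"
      using PP' by (intro levenshtein_windows) auto
    moreover have "\<bar>real Q - real P\<bar> \<le> real c + real T" using P by linarith
    moreover have "\<bar>real (Q + N) - real P'\<bar> \<le> real c + 2 * real T + real b" using P' by linarith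
    ultimately have 4: "2 * levenshtein ?VY ?WY \<le> 2 * real c + 3 * real T + real b" by linarith
    have 3: "levenshtein ?VX ?VY \<le> \<epsilon> * real N + C"
      unfolding levenshtein_commute[of ?VX] by (rule C)
    have "levenshtein (ext (X N)) (ext (Y N)) \<le> levenshtein (ext (X N)) ?WX + levenshtein ?WX ?VX
        + levenshtein ?VX ?VY + levenshtein ?VY ?WY + levenshtein ?WY (ext (Y N))"
      using levenshtein_triangle[of "ext (X N)" "ext (Y N)" ?WX]
        levenshtein_triangle[of ?WX "ext (Y N)" ?VX] levenshtein_triangle[of ?VX "ext (Y N)" ?VY]
        levenshtein_triangle[of ?VY "ext (Y N)" ?WY] by linarith
    with 1 2 3 4 5 show "levenshtein (ext (X N)) (ext (Y N))
        \<le> \<epsilon> * real N + (C + 4 * real T + real b + real c)"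
      by linarith
  qed
qed

text \<open>Up to constants, every window of an image is the image of a finite word. Such words can
  be copied into the blocks \<open>G n\<close> of other points.\<close>

lemma dill_window_idx:
  fixes x k n
  defines "w \<equiv> window x (idx x k) (idx x (k + n))"
  shows "length (ext w) \<le> n + (2 * \<theta> + 1) * M" "n \<le> length (ext w) + (2 * \<theta> + 1) * M"
    "levenshtein (window (dill x) k (k + n)) (ext w) \<le> (2 * \<theta> + 1) * M"
proof -
  define i where "i = idx x k"
  define j where "j = idx x (k + n)"
  define T where "T = \<theta> * M"
  define c where "c = (\<theta> + 1) * M"
  have cT: "(2 * \<theta> + 1) * M = c + T" by (simp add: c_def T_def algebra_simps)
  have w: "w = window x i j" by (simp add: w_def i_def j_def)
  have ij: "i \<le> j" unfolding i_def j_def by (rule idx_mono) simp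
  have pi: "k \<le> pos x i" "pos x i \<le> k + c" and pj: "k + n \<le> pos x j" "pos x j \<le> k + n + c"
    unfolding i_def j_def c_def by (rule pos_idx)+
  have "pos x i + length (ext w) \<le> pos x j" "pos x j \<le> pos x i + length (ext w) + T"
    unfolding w T_def
    using length_ext_append_ge[of "window x 0 i" "window x i j"]
      length_ext_append_le[of "window x 0 i" "window x i j"] ij
    by (simp_all add: window_append)
  with pi pj show "length (ext w) \<le> n + (2 * \<theta> + 1) * M" "n \<le> length (ext w) + (2 * \<theta> + 1) * M"
    unfolding cT by linarith+
  let ?F = "window (dill x) k (k + n)" and ?G = "window (dill x) (pos x i) (pos x j)"
  have "2 * levenshtein ?F ?G \<le> \<bar>real k - real (pos x i)\<bar> + \<bar>real (k + n) - real (pos x j)\<bar>"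
    using ij by (intro levenshtein_windows pos_mono) auto
  moreover have "\<bar>real k - real (pos x i)\<bar> \<le> real c" "\<bar>real (k + n) - real (pos x j)\<bar> \<le> real c"
    using pi pj by linarith+
  ultimately have "levenshtein ?F ?G \<le> real c" by linarith
  moreover have "levenshtein ?G (ext w) \<le> real T"
    unfolding T_def w using ij by (rule dill_window_factor)
  ultimately show "levenshtein ?F (ext w) \<le> (2 * \<theta> + 1) * M"
    using levenshtein_triangle[of ?F "ext w" ?G] unfolding cT by linarith
qed

lemma not_diamond_uniform_W_L:
  assumes pres: "\<And>x y. W_L x y = 0 \<Longrightarrow> W_L (dill x) (dill y) = 0"
    and "\<not> diamond_uniform \<theta> f"
  shows "W_L (dill x) (dill y) = 0"
proof -
  obtain u v where uv: "\<theta> \<le> length u" "length v = length u"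
      "take \<theta> u = take \<theta> v" "drop (length u - \<theta>) u = drop (length u - \<theta>) v"
    and less: "length (ext u) < length (ext v)"
  proof -
    obtain l u v where l: "\<theta> \<le> l" "length u = l" "length v = l"
      "take \<theta> u = take \<theta> v" "drop (l - \<theta>) u = drop (l - \<theta>) v"
      and ne: "length (ext u) \<noteq> length (ext v)"
      using assms(2) unfolding diamond_uniform_def not_all not_imp by blast
    show thesis
    proof (cases "length (ext u) < length (ext v)")
      case True
      then show thesis using l by (intro that[of u v]) simp_all
    next
      case False
      then show thesis using l ne by (intro that[of v u]) simp_all
    qed
  qed
  \<comment> \<open>The construction takes one pair of words per length, so for each
    \<open>n\<close> the position \<open>k n\<close> where the images are farthest apart is
    used.\<close>
  obtain k where k: "\<And>n k'. levenshtein (window (dill x) k' (k' + n)) (window (dill y) k' (k' + n))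
      \<le> levenshtein (window (dill x) (k n) (k n + n)) (window (dill y) (k n) (k n + n))"
    using levenshtein_max_shift[of "dill x" _ "dill y"] by metis
  define b where "b = (2 * \<theta> + 1) * M"
  define X where "X n = window x (idx x (k n)) (idx x (k n + n))" for n
  define Y where "Y n = window y (idx y (k n)) (idx y (k n + n))" for n
  show ?thesis
    unfolding W_L_eq_0_iff
  proof (intro allI impI)
    fix \<epsilon> :: real assume eps: "\<epsilon> > 0"
    have "\<exists>C. \<forall>n. levenshtein (ext (X n)) (ext (Y n)) \<le> \<epsilon> * real n + C"
      by (rule levenshtein_ext_sublinear[OF pres uv less, where b = b])
        (simp_all only: X_def Y_def b_def dill_window_idx eps)
    then obtain C where C: "\<And>n. levenshtein (ext (X n)) (ext (Y n)) \<le> \<epsilon> * real n + C" by blast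
    show "\<exists>C. \<forall>k l. levenshtein (window (dill x) k (k + l)) (window (dill y) k (k + l)) \<le> \<epsilon> * real l + C"
    proof (intro exI allI)
      fix k' n
      let ?Fx = "window (dill x) (k n) (k n + n)" and ?Fy = "window (dill y) (k n) (k n + n)"
      have "levenshtein ?Fx (ext (X n)) \<le> b" unfolding X_def b_def by (rule dill_window_idx)
      moreover have "levenshtein (ext (Y n)) ?Fy \<le> b"
        unfolding Y_def b_def levenshtein_commute[of _ ?Fy] by (rule dill_window_idx)
      ultimately have "levenshtein ?Fx ?Fy \<le> \<epsilon> * real n + (C + 2 * real b)"
        using C[of n] levenshtein_triangle[of ?Fx ?Fy "ext (X n)"]
          levenshtein_triangle[of "ext (X n)" ?Fy "ext (Y n)"] by linarith
      with k[of k' n] show "levenshtein (window (dill x) k' (k' + n)) (window (dill y) k' (k' + n))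
          \<le> \<epsilon> * real n + (C + 2 * real b)"
        by linarith
    qed
  qed
qed

end

theorem theorem3:
  fixes F :: "(nat \<Rightarrow> 'a::finite) \<Rightarrow> (nat \<Rightarrow> 'a)"
    and f :: "'a list \<Rightarrow> 'a list"
    and \<theta> :: nat
  assumes "is_dill_map \<theta> f F"
  shows "(\<forall>x y. W_L x y = 0 \<longrightarrow> W_L (F x) (F y) = 0)
         \<longleftrightarrow> W_L_constant F \<or> diamond_uniform \<theta> f"
proof -
  define M where "M = Max ((\<lambda>u. length (f u)) ` {u. length u = \<theta>})"
  have fin: "finite {u :: 'a list. length u = \<theta>}"
    using finite_lists_length_eq[of "UNIV :: 'a set" \<theta>] by simp
  interpret dill_rule \<theta> f M
  proof
    show "0 < \<theta>" using assms by (simp add: is_dill_map_def)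
    show "f u \<noteq> []" if "length u = \<theta>" for u using assms that by (simp add: is_dill_map_def)
    show "length (f u) \<le> M" if "length u = \<theta>" for u
      unfolding M_def using fin that by (intro Max_ge) auto
  qed
  have F: "F = dill" using assms by (simp add: is_dill_map_def dill_def fun_eq_iff)
  show ?thesis
    unfolding F W_L_constant_def
    using diamond_uniform_W_L not_diamond_uniform_W_L by blast
qed

end
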